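(* Let $R$ be a Noetherian unique factorization domain which is not a field, let $f_1,\ldots,f_n,f\in R$ with some $f_i\neq 0$, let $J=(f_1,\ldots,f_n,f)\subseteq R$, and let $A=R[T_1,\ldots,T_n]/(f_1T_1+\cdots+f_nT_n+f)$. Then $A$ is an integral domain if and only if $J=R$ or $\operatorname{ht} J\geq 2$.
   Context: For a proper ideal $J$, $\operatorname{ht} J$ is the minimum of the heights of the prime ideals containing $J$. *)

theory Defs
  imports "HOL-Algebra.Indexed_Polynomials" "HOL-Algebra.QuotRing" "HOL-Algebra.Ring_Divisibility"
    "HOL-Library.Extended_Nat"
begin

text \<open>
  The library theory of indexed polynomials provides the set of polynomials over \<^term>\<open>R\<close> with
  variables indexed by \<^term>\<open>I\<close> (coefficient functions on monomials, which are multisets of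
  indices), their addition, the constants and the variables, but no product of two polynomials.
  The product is the Cauchy product: the coefficient at the monomial \<^term>\<open>m\<close> sums over all
  factorizations of \<^term>\<open>m\<close> into \<^term>\<open>a\<close> and \<^term>\<open>m - a\<close>.
\<close>

definition mpoly_mult ::
  "('a, 'b) ring_scheme \<Rightarrow> ('c multiset \<Rightarrow> 'a) \<Rightarrow> ('c multiset \<Rightarrow> 'a) \<Rightarrow> ('c multiset \<Rightarrow> 'a)" where
  "mpoly_mult R p q = (\<lambda>m. \<Oplus>\<^bsub>R\<^esub>a\<in>{a. a \<subseteq># m}. p a \<otimes>\<^bsub>R\<^esub> q (m - a))"

definition mpoly_ring :: "('a, 'b) ring_scheme \<Rightarrow> 'c set \<Rightarrow> ('c multiset \<Rightarrow> 'a) ring" where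
  "mpoly_ring R I =
    \<lparr>carrier = ring.indexed_pset R I (carrier R),
     monoid.mult = mpoly_mult R,
     one = ring.indexed_const R \<one>\<^bsub>R\<^esub>,
     zero = ring.indexed_const R \<zero>\<^bsub>R\<^esub>,
     add = ring.indexed_padd R\<rparr>"

text \<open>The supremum of the lengths of the chains of prime ideals
  \<open>Q 0 \<subset> \<dots> \<subset> Q k = P\<close>; such a chain has length \<^term>\<open>k\<close>.\<close>

definition prime_height :: "('a, 'b) ring_scheme \<Rightarrow> 'a set \<Rightarrow> enat" where
  "prime_height R P =
    (SUP k \<in> {k. \<exists>Q :: nat \<Rightarrow> 'a set. (\<forall>i\<le>k. primeideal (Q i) R) \<and>
                 (\<forall>i<k. Q i \<subset> Q (Suc i)) \<and> Q k = P}. enat k)"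

text \<open>For a proper ideal \<^term>\<open>J\<close> the infimum is a minimum, because \<^typ>\<open>enat\<close> is well-ordered
  and some prime ideal contains \<^term>\<open>J\<close>. It is \<open>\<infinity>\<close> when \<^term>\<open>J\<close> is the whole ring, a case
  outside the usual definition.\<close>

definition ideal_height :: "('a, 'b) ring_scheme \<Rightarrow> 'a set \<Rightarrow> enat" where
  "ideal_height R J = (INF P \<in> {P. primeideal P R \<and> J \<subseteq> P}. prime_height R P)"

end

theory Submission
  imports Defs "HOL-Library.Multiset_Order"
begin

text \<open>
  Write \<open>S = R[T\<^sub>1, \<dots>, T\<^sub>n]\<close> and \<open>F = f\<^sub>1 T\<^sub>1 + \<dots> + f\<^sub>n T\<^sub>n + f\<close>. Both sides of the equivalence
  say that \<open>F\<close> is primitive: no prime element \<open>p\<close> of \<open>R\<close> divides all of \<open>f\<^sub>1, \<dots>, f\<^sub>n, f\<close>, in other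
  words \<open>J\<close> lies in no ideal \<open>(p)\<close>.

  For the height (\<open>ideal_height_ge_2_iff\<close>): only the zero ideal is a prime ideal strictly inside
  \<open>(p)\<close>, so \<open>J \<subseteq> (p)\<close> forces \<open>ht J \<le> 1\<close>. Conversely, a prime ideal \<open>P \<supseteq> J\<close> contains a prime factor
  \<open>p\<close> of some nonzero element of \<open>J\<close>; as \<open>J\<close> is not inside \<open>(p)\<close>, the chain \<open>0 \<subset> (p) \<subset> P\<close> is strict.

  If a prime \<open>p\<close> divides all coefficients, then \<open>F = Q p\<close> is a factorization in which neither factor
  is a multiple of \<open>F\<close>, so the quotient has zero divisors
  (\<open>linear_imprimitive_quotient_not_domain\<close>).

  Let \<open>F\<close> be primitive and pick \<open>k\<close> with \<open>a = f\<^sub>k \<noteq> 0\<close>. Modulo \<open>F\<close> the equation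
  \<open>a T\<^sub>k = g\<close> holds with \<open>g\<close> free of \<open>T\<^sub>k\<close>, so inverting \<open>a\<close> would turn \<open>S/(F)\<close> into a
  polynomial ring in the other variables, which is a domain. Without fractions this reads: a power of
  \<open>a\<close> moves every class of \<open>S/(F)\<close> to the class of a polynomial free of \<open>T\<^sub>k\<close>
  (\<open>eliminate_variable\<close>), and among these polynomials only \<open>0\<close> is a multiple of \<open>F\<close>
  (\<open>mpoly_linear_multiple\<close>). What is left is that \<open>a\<close> is a nonzerodivisor modulo \<open>F\<close>
  (\<open>mpoly_cancel_const\<close>), and here primitivity enters: it suffices to cancel one prime \<open>p\<close> at a
  time, and if \<open>p E = H F\<close>, then Gauss's lemma (\<open>mpoly_mult_coeffs_in_primeideal\<close>) makes \<open>p\<close>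
  divide \<open>H\<close>, so that \<open>E\<close> is already a multiple of \<open>F\<close>.
\<close>

section \<open>The ring of polynomials in a set of variables\<close>

lemma finite_submultisets: "finite {a. a \<subseteq># m}"
proof (induction m)
  case (add x m)
  have "{a. a \<subseteq># add_mset x m} \<subseteq> {a. a \<subseteq># m} \<union> add_mset x ` {a. a \<subseteq># m}"
  proof
    fix a assume a: "a \<in> {a. a \<subseteq># add_mset x m}"
    show "a \<in> {a. a \<subseteq># m} \<union> add_mset x ` {a. a \<subseteq># m}"
    proof (cases "x \<in># a")
      case True
      then obtain b where "a = add_mset x b" by (metis multi_member_split)
      then show ?thesis using a by auto
    next
      case False
      then show ?thesis using a
        by (metis UnI1 diff_single_trivial mem_Collect_eq subset_eq_diff_conv add_mset_add_single)
    qed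
  qed
  then show ?case using add by (meson finite_UnI finite_imageI finite_subset)
qed simp

context cring
begin

lemma mpoly_coeff_closed: "P \<in> (carrier R)[\<X>\<^bsub>I\<^esub>] \<Longrightarrow> P m \<in> carrier R"
  using indexed_pset_in_carrier[of "carrier R"] carrier_coeffE by blast

lemma mpoly_mult_carrier_coeff:
  assumes "carrier_coeff p" "carrier_coeff q" shows "carrier_coeff (mpoly_mult R p q)"
  using assms unfolding carrier_coeff_def mpoly_mult_def by (auto intro!: finsum_closed)

lemma mpoly_mult_comm:
  fixes p q :: "'c multiset \<Rightarrow> 'a"
  assumes "carrier_coeff p" "carrier_coeff q"
  shows "mpoly_mult R p q = mpoly_mult R q p"
proof
  fix m :: "'c multiset"
  \<comment> \<open>Complementation \<open>a \<mapsto> m - a\<close> permutes the divisors of the monomial \<open>m\<close>.\<close>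
  have bij: "(\<lambda>a. m - a) ` {a. a \<subseteq># m} = {a. a \<subseteq># m}" (is "?h ` ?A = _")
    by (auto simp: image_iff) (metis diff_subset_eq_self subset_mset.diff_diff_right add_diff_cancel_left')
  have inj: "inj_on ?h ?A"
    by (rule inj_on_inverseI[where g = ?h]) (metis mem_Collect_eq subset_mset.add_diff_inverse add_diff_cancel_right')
  have "(\<Oplus>a\<in>?h ` ?A. q a \<otimes> p (m - a)) = (\<Oplus>a\<in>?A. q (m - a) \<otimes> p (m - (m - a)))"
    using assms by (intro finsum_reindex inj) (auto simp: carrier_coeff_def)
  also have "\<dots> = (\<Oplus>a\<in>?A. p a \<otimes> q (m - a))"
  proof (intro finsum_cong' refl)
    fix a assume "a \<in> ?A"
    then have "m - (m - a) = a"
      by (metis mem_Collect_eq subset_mset.add_diff_inverse add_diff_cancel_right')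
    then show "q (m - a) \<otimes> p (m - (m - a)) = p a \<otimes> q (m - a)"
      using assms m_comm by (auto simp: carrier_coeff_def)
  qed (use assms in \<open>auto simp: carrier_coeff_def\<close>)
  finally show "mpoly_mult R p q m = mpoly_mult R q p m"
    unfolding mpoly_mult_def bij by simp
qed

lemma mpoly_mult_padd:
  assumes "carrier_coeff p" "carrier_coeff q" "carrier_coeff r"
  shows "mpoly_mult R p (indexed_padd q r) = indexed_padd (mpoly_mult R p q) (mpoly_mult R p r)"
proof
  fix m
  have "(\<Oplus>a\<in>{a. a \<subseteq># m}. p a \<otimes> (q (m - a) \<oplus> r (m - a)))
      = (\<Oplus>a\<in>{a. a \<subseteq># m}. p a \<otimes> q (m - a) \<oplus> p a \<otimes> r (m - a))"
    using assms by (intro finsum_cong' refl) (auto simp: carrier_coeff_def r_distr)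
  also have "\<dots> = (\<Oplus>a\<in>{a. a \<subseteq># m}. p a \<otimes> q (m - a)) \<oplus> (\<Oplus>a\<in>{a. a \<subseteq># m}. p a \<otimes> r (m - a))"
    using assms by (intro finsum_addf) (auto simp: carrier_coeff_def)
  finally show "mpoly_mult R p (indexed_padd q r) m = indexed_padd (mpoly_mult R p q) (mpoly_mult R p r) m"
    by (simp add: mpoly_mult_def indexed_padd_def)
qed

lemma mpoly_mult_const:
  assumes "carrier_coeff p" "c \<in> carrier R"
  shows "mpoly_mult R p (indexed_const c) = (\<lambda>m. p m \<otimes> c)"
proof
  fix m
  have "(\<Oplus>a\<in>{a. a \<subseteq># m}. p a \<otimes> indexed_const c (m - a)) = (\<Oplus>a\<in>{m}. p m \<otimes> c)"
    using assms
    by (intro add.finprod_mono_neutral_cong_right finite_submultisets)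
       (auto simp: carrier_coeff_def indexed_const_def dest: subset_mset.antisym simp: Diff_eq_empty_iff_mset)
  then show "mpoly_mult R p (indexed_const c) m = p m \<otimes> c"
    using assms by (simp add: mpoly_mult_def carrier_coeff_def)
qed

text \<open>
  Together with the two preceding lemmas this describes multiplication on generators: every
  polynomial arises from constants by addition and multiplication by variables, so the ring laws
  follow by induction along this construction, without exchanging double sums over divisors of a
  monomial.
\<close>
lemma mpoly_mult_pmult:
  assumes "carrier_coeff p" "carrier_coeff q"
  shows "mpoly_mult R p (indexed_pmult q i) = indexed_pmult (mpoly_mult R p q) i"
proof
  fix m
  let ?f = "\<lambda>a. p a \<otimes> indexed_pmult q i (m - a)"
  show "mpoly_mult R p (indexed_pmult q i) m = indexed_pmult (mpoly_mult R p q) i m"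
  proof (cases "i \<in># m")
    case False
    then have "?f a = \<zero>" for a
      using assms in_diffD[of i m a] by (auto simp: carrier_coeff_def indexed_pmult_def)
    then show ?thesis using False by (simp add: mpoly_mult_def indexed_pmult_def)
  next
    case True
    then obtain n where m: "m = add_mset i n" by (metis multi_member_split)
    have in_diff: "i \<in># m - a \<longleftrightarrow> a \<subseteq># n" if "a \<subseteq># m" for a
    proof
      assume "i \<in># m - a"
      then show "a \<subseteq># n"
        using that unfolding m subseteq_mset_def
        by (metis count_add_mset count_greater_zero_iff in_diff_count less_Suc_eq_le)
    next
      assume "a \<subseteq># n"
      then show "i \<in># m - a"
        unfolding m in_diff_count subseteq_mset_def by (simp add: le_imp_less_Suc)
    qed
    have "(\<Oplus>a\<in>{a. a \<subseteq># m}. ?f a) = (\<Oplus>a\<in>{a. a \<subseteq># n}. p a \<otimes> q (n - a))"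
    proof (intro add.finprod_mono_neutral_cong_right finite_submultisets)
      show "{a. a \<subseteq># n} \<subseteq> {a. a \<subseteq># m}" by (auto simp: m intro: subset_mset.order_trans)
      show "?f a = \<zero>" if "a \<in> {a. a \<subseteq># m} - {a. a \<subseteq># n}" for a
        using that in_diff assms by (auto simp: carrier_coeff_def indexed_pmult_def)
      show "?f a = p a \<otimes> q (n - a)" if "a \<in> {a. a \<subseteq># n}" for a
      proof -
        have "a \<subseteq># m" using that by (auto simp: m intro: subset_mset.order_trans)
        moreover have "m - a - {#i#} = n - a" using that unfolding m by (simp add: diff_right_commute)
        ultimately show ?thesis using that in_diff[of a] by (simp add: indexed_pmult_def)
      qed
    qed (use assms in \<open>auto simp: carrier_coeff_def indexed_pmult_def\<close>)
    then show ?thesis using True by (simp add: mpoly_mult_def indexed_pmult_def m)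
  qed
qed

end

lemma mpoly_ring_simps [simp]:
  "carrier (mpoly_ring R I) = ring.indexed_pset R I (carrier R)"
  "monoid.mult (mpoly_ring R I) = mpoly_mult R"
  "one (mpoly_ring R I) = ring.indexed_const R \<one>\<^bsub>R\<^esub>"
  "zero (mpoly_ring R I) = ring.indexed_const R \<zero>\<^bsub>R\<^esub>"
  "add (mpoly_ring R I) = ring.indexed_padd R"
  by (simp_all add: mpoly_ring_def)

context cring
begin

lemma carrier_coeff_const [simp]: "c \<in> carrier R \<Longrightarrow> carrier_coeff (indexed_const c)"
  by (auto simp: carrier_coeff_def indexed_const_def)

lemma mpoly_carrier_coeff: "P \<in> (carrier R)[\<X>\<^bsub>I\<^esub>] \<Longrightarrow> carrier_coeff P"
  using indexed_pset_in_carrier[of "carrier R"] by blast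

lemma mpoly_mult_closed:
  fixes p q :: "'c multiset \<Rightarrow> 'a"
  assumes "p \<in> (carrier R)[\<X>\<^bsub>I\<^esub>]" "q \<in> (carrier R)[\<X>\<^bsub>I\<^esub>]"
  shows "mpoly_mult R p q \<in> (carrier R)[\<X>\<^bsub>I\<^esub>]"
  using assms(2)
proof induction
  case (indexed_const c)
  have "(\<lambda>m. p m \<otimes> c) \<in> (carrier R)[\<X>\<^bsub>I\<^esub>]"
    using assms(1)
  proof induction
    case (indexed_const k)
    have "(\<lambda>m :: 'c multiset. indexed_const k m \<otimes> c) = indexed_const (k \<otimes> c)"
      using \<open>c \<in> carrier R\<close> by (auto simp: indexed_const_def)
    then show ?case using indexed_const \<open>c \<in> carrier R\<close> by (simp add: indexed_pset.indexed_const)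
  next
    case (indexed_padd P Q)
    have "(\<lambda>m. indexed_padd P Q m \<otimes> c) = indexed_padd (\<lambda>m. P m \<otimes> c) (\<lambda>m. Q m \<otimes> c)"
      using \<open>c \<in> carrier R\<close> indexed_padd.hyps[THEN mpoly_coeff_closed]
      by (auto simp: indexed_padd_def l_distr)
    then show ?case using indexed_padd by (simp add: indexed_pset.indexed_padd)
  next
    case (indexed_pmult P i)
    have "(\<lambda>m. indexed_pmult P i m \<otimes> c) = indexed_pmult (\<lambda>m. P m \<otimes> c) i"
      using \<open>c \<in> carrier R\<close> by (auto simp: indexed_pmult_def)
    then show ?case using indexed_pmult by (simp add: indexed_pset.indexed_pmult)
  qed
  then show ?case using indexed_const assms(1) by (simp add: mpoly_mult_const mpoly_carrier_coeff)
next
  case (indexed_padd P Q)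
  then show ?case
    using assms(1) by (simp add: mpoly_mult_padd mpoly_carrier_coeff indexed_pset.indexed_padd)
next
  case (indexed_pmult P i)
  then show ?case
    using assms(1) by (simp add: mpoly_mult_pmult mpoly_carrier_coeff indexed_pset.indexed_pmult)
qed

lemma mpoly_mult_assoc:
  assumes "carrier_coeff p" "carrier_coeff q" "r \<in> (carrier R)[\<X>\<^bsub>I\<^esub>]"
  shows "mpoly_mult R (mpoly_mult R p q) r = mpoly_mult R p (mpoly_mult R q r)"
  using assms(3)
proof induction
  case (indexed_const c)
  show ?case
  proof
    fix m
    have "(\<Oplus>a\<in>{a. a \<subseteq># m}. p a \<otimes> q (m - a)) \<otimes> c = (\<Oplus>a\<in>{a. a \<subseteq># m}. (p a \<otimes> q (m - a)) \<otimes> c)"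
      using assms indexed_const
      by (intro finsum_ldistr finite_submultisets) (auto simp: carrier_coeff_def)
    also have "\<dots> = (\<Oplus>a\<in>{a. a \<subseteq># m}. p a \<otimes> (q (m - a) \<otimes> c))"
      using assms indexed_const by (intro finsum_cong' refl) (auto simp: carrier_coeff_def m_assoc)
    finally show "mpoly_mult R (mpoly_mult R p q) (indexed_const c) m
        = mpoly_mult R p (mpoly_mult R q (indexed_const c)) m"
      using assms indexed_const
      by (simp add: mpoly_mult_const mpoly_mult_carrier_coeff) (simp add: mpoly_mult_def)
  qed
next
  case (indexed_padd P Q)
  then show ?case using assms
    by (simp add: mpoly_mult_padd mpoly_mult_carrier_coeff mpoly_carrier_coeff)
next
  case (indexed_pmult P i)
  then show ?case using assms
    by (simp add: mpoly_mult_pmult mpoly_mult_carrier_coeff mpoly_carrier_coeff)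
qed

lemma mpoly_mult_one: "carrier_coeff p \<Longrightarrow> mpoly_mult R p (indexed_const \<one>) = p"
  by (auto simp: mpoly_mult_const carrier_coeff_def)

lemma mpoly_ring_cring: "cring (mpoly_ring R I)"
proof (rule cringI)
  show "abelian_group (mpoly_ring R I)"
  proof (rule abelian_groupI; clarsimp)
    fix p assume p: "p \<in> (carrier R)[\<X>\<^bsub>I\<^esub>]"
    define q where "q = mpoly_mult R p (indexed_const (\<ominus> \<one>))"
    have "q \<in> (carrier R)[\<X>\<^bsub>I\<^esub>]"
      unfolding q_def using p by (intro mpoly_mult_closed) (auto intro: indexed_pset.indexed_const)
    moreover have "indexed_padd q p = indexed_const \<zero>"
      using p mpoly_coeff_closed[OF p] unfolding q_def
      by (auto simp: mpoly_mult_const mpoly_carrier_coeff indexed_padd_def indexed_zero_def r_minus l_neg)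
    ultimately show "\<exists>q\<in>(carrier R)[\<X>\<^bsub>I\<^esub>]. indexed_padd q p = indexed_const \<zero>" by blast
  qed (auto simp: indexed_pset.intros, auto simp: indexed_padd_def indexed_zero_def fun_eq_iff a_ac mpoly_coeff_closed)
  show "comm_monoid (mpoly_ring R I)"
    by (rule comm_monoidI)
       (auto simp: mpoly_mult_closed mpoly_mult_assoc mpoly_mult_comm[OF mpoly_carrier_coeff mpoly_carrier_coeff]
           mpoly_carrier_coeff mpoly_mult_comm[of "indexed_const \<one>"] mpoly_mult_one
         intro: indexed_pset.indexed_const)
next
  fix p q r
  assume "p \<in> carrier (mpoly_ring R I)" "q \<in> carrier (mpoly_ring R I)" "r \<in> carrier (mpoly_ring R I)"
  then show "(p \<oplus>\<^bsub>mpoly_ring R I\<^esub> q) \<otimes>\<^bsub>mpoly_ring R I\<^esub> r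
      = p \<otimes>\<^bsub>mpoly_ring R I\<^esub> r \<oplus>\<^bsub>mpoly_ring R I\<^esub> q \<otimes>\<^bsub>mpoly_ring R I\<^esub> r"
    by (simp add: mpoly_carrier_coeff mpoly_mult_comm[of _ r] mpoly_mult_padd indexed_padd_in_carrier)
qed

end

section \<open>Polynomials as finitely supported coefficient functions\<close>

context cring
begin

lemma mpoly_finite_support:
  assumes "P \<in> (carrier R)[\<X>\<^bsub>I\<^esub>]" shows "finite {m. P m \<noteq> \<zero>}"
  using assms
proof induction
  case (indexed_const k)
  show ?case by (rule finite_subset[of _ "{{#}}"]) (auto simp: indexed_const_def)
next
  case (indexed_padd P Q)
  show ?case
    by (rule finite_subset[OF _ finite_UnI[OF indexed_padd.IH]]) (auto simp: indexed_padd_def)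
next
  case (indexed_pmult P i)
  have "{m. indexed_pmult P i m \<noteq> \<zero>} \<subseteq> add_mset i ` {m. P m \<noteq> \<zero>}"
    by (auto simp: indexed_pmult_def image_iff intro!: exI[of _ "_ - {#i#}"] split: if_splits)
  then show ?case using indexed_pmult.IH finite_surj by blast
qed

lemma mpoly_support_vars:
  assumes "P \<in> (carrier R)[\<X>\<^bsub>I\<^esub>]" "P m \<noteq> \<zero>" shows "set_mset m \<subseteq> I"
  using assms
proof (induction arbitrary: m)
  case (indexed_padd P Q)
  then have "P m \<noteq> \<zero> \<or> Q m \<noteq> \<zero>" by (auto simp: indexed_padd_def)
  then show ?case using indexed_padd.IH by blast
next
  case (indexed_pmult P i)
  then have "i \<in># m" "P (m - {#i#}) \<noteq> \<zero>" by (auto simp: indexed_pmult_def split: if_splits)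
  then show ?case using indexed_pmult by (metis insert_DiffM insert_subset set_mset_add_mset_insert)
qed (auto simp: indexed_const_def split: if_splits)

text \<open>
  The converse of the two preceding lemmas: a finitely supported coefficient function is a sum of
  monomials. It yields membership for polynomials given by their coefficients, such as quotients by a
  constant.
\<close>
lemma mpoly_memI:
  assumes "carrier_coeff P" "finite {m. P m \<noteq> \<zero>}" "\<And>m. P m \<noteq> \<zero> \<Longrightarrow> set_mset m \<subseteq> I"
  shows "P \<in> (carrier R)[\<X>\<^bsub>I\<^esub>]"
proof -
  have monomial: "(\<lambda>m'. if m' = m then c else \<zero>) \<in> (carrier R)[\<X>\<^bsub>I\<^esub>]"
    if "set_mset m \<subseteq> I" "c \<in> carrier R" for m c
    using that
  proof (induction m)
    case empty
    then show ?case using indexed_pset.indexed_const[of c "carrier R" I] by (simp add: indexed_const_def)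
  next
    case (add i m)
    have "(\<lambda>m'. if m' = add_mset i m then c else \<zero>) = indexed_pmult (\<lambda>m'. if m' = m then c else \<zero>) i"
      by (auto simp: indexed_pmult_def fun_eq_iff)
    then show ?case using add by (simp add: indexed_pset.indexed_pmult)
  qed
  have "P \<in> (carrier R)[\<X>\<^bsub>I\<^esub>]"
    if "finite A" "{m. P m \<noteq> \<zero>} = A" "carrier_coeff P" "\<forall>m\<in>A. set_mset m \<subseteq> I" for A P
    using that
  proof (induction arbitrary: P)
    case empty
    then have "P = indexed_const \<zero>" by (auto simp: indexed_zero_def)
    then show ?case by (auto intro: indexed_pset.indexed_const)
  next
    case (insert m A)
    have "P(m := \<zero>) \<in> (carrier R)[\<X>\<^bsub>I\<^esub>]"
      using insert.prems insert.hyps by (intro insert.IH) (auto simp: carrier_coeff_def)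
    moreover have "P = indexed_padd (P(m := \<zero>)) (\<lambda>m'. if m' = m then P m else \<zero>)"
      using insert.prems by (auto simp: indexed_padd_def carrier_coeff_def fun_eq_iff)
    ultimately show ?case
      using monomial[of m "P m"] insert.prems by (metis indexed_pset.indexed_padd carrier_coeffE insertI1)
  qed
  then show ?thesis using assms by blast
qed

end

section \<open>Gauss's lemma\<close>

lemma (in ideal) finsum_mem:
  assumes "\<And>a. a \<in> A \<Longrightarrow> h a \<in> I"
  shows "(\<Oplus>a\<in>A. h a) \<in> I"
proof (cases "finite A")
  case True
  then show ?thesis using assms
  proof (induction A)
    case (insert a A)
    have "(\<Oplus>a\<in>insert a A. h a) = h a \<oplus> (\<Oplus>a\<in>A. h a)"
      using insert.hyps insert.prems Icarr by (intro finsum_insert) auto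
    then show ?case using insert by (simp add: a_closed)
  qed (simp add: zero_closed)
qed (simp add: finsum_infinite zero_closed)

context cring
begin

text \<open>
  Gauss's lemma in a form that covers both integrality of the polynomial ring (for the zero ideal) and
  primality of constants (for principal ideals). Monomials over linearly ordered variables carry a
  linear order compatible with multiplication. If \<open>s\<close> and \<open>t\<close> are the largest monomials of \<open>p\<close>
  and \<open>q\<close> with coefficients outside \<open>Q\<close>, then at the monomial \<open>s + t\<close> every term of the Cauchy
  product except \<open>p s \<otimes> q t\<close> lies in \<open>Q\<close>.
\<close>
lemma mpoly_mult_coeffs_in_primeideal:
  fixes p q :: "'c::linorder multiset \<Rightarrow> 'a"
  assumes "primeideal Q R" and p: "p \<in> (carrier R)[\<X>\<^bsub>I\<^esub>]" and q: "q \<in> (carrier R)[\<X>\<^bsub>I\<^esub>]"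
    and pq: "\<And>m. mpoly_mult R p q m \<in> Q"
  shows "(\<forall>m. p m \<in> Q) \<or> (\<forall>m. q m \<in> Q)"
proof (rule ccontr)
  interpret Q: primeideal Q R by fact
  assume "\<not> ?thesis"
  then have ne: "{m. p m \<notin> Q} \<noteq> {}" "{m. q m \<notin> Q} \<noteq> {}" by auto
  have fin: "finite {m. p m \<notin> Q}" "finite {m. q m \<notin> Q}"
    by (rule finite_subset[OF _ mpoly_finite_support[OF p]], auto)
       (rule finite_subset[OF _ mpoly_finite_support[OF q]], auto)
  \<comment> \<open>The leading monomials modulo \<open>Q\<close>.\<close>
  define s where "s = Max {m. p m \<notin> Q}"
  define t where "t = Max {m. q m \<notin> Q}"
  have s: "p s \<notin> Q" and t: "q t \<notin> Q"
    using Max_in[OF fin(1) ne(1)] Max_in[OF fin(2) ne(2)] by (auto simp: s_def t_def)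
  have above_s: "p m \<in> Q" if "s < m" for m
    using Max_ge[OF fin(1), of m] that using not_le unfolding s_def by blast
  have above_t: "q m \<in> Q" if "t < m" for m
    using Max_ge[OF fin(2), of m] that using not_le unfolding t_def by blast
  let ?A = "{a. a \<subseteq># s + t} - {s}"
  let ?h = "\<lambda>a. p a \<otimes> q (s + t - a)"
  have h_closed: "?h a \<in> carrier R" for a using p q by (simp add: mpoly_coeff_closed)
  have "?h a \<in> Q" if "a \<in> ?A" for a
  proof -
    have "a \<subseteq># s + t" "a \<noteq> s" using that by auto
    then obtain b where b: "s + t = a + b" by (metis subset_mset.add_diff_inverse)
    have "s < a \<or> t < b"
    proof (rule ccontr)
      assume "\<not> ?thesis"
      then have "a < s" "b \<le> t" using \<open>a \<noteq> s\<close> by auto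
      then have "a + b < s + t" by (rule add_less_le_mono)
      then show False using b by simp
    qed
    then show ?thesis
      using b p q above_s above_t Q.I_l_closed Q.I_r_closed by (auto simp: mpoly_coeff_closed)
  qed
  then have rest: "(\<Oplus>a\<in>?A. ?h a) \<in> Q" by (rule Q.finsum_mem)
  have "{a. a \<subseteq># s + t} = insert s ?A" by auto
  then have "mpoly_mult R p q (s + t) = (\<Oplus>a\<in>insert s ?A. ?h a)"
    by (simp add: mpoly_mult_def)
  also have "\<dots> = p s \<otimes> q t \<oplus> (\<Oplus>a\<in>?A. ?h a)"
    using h_closed finite_submultisets[of "s + t"] h_closed[of s] by (subst finsum_insert) auto
  finally have "p s \<otimes> q t = mpoly_mult R p q (s + t) \<ominus> (\<Oplus>a\<in>?A. ?h a)"
    using p q h_closed by (simp add: mpoly_coeff_closed minus_eq a_assoc r_neg)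
  then have "p s \<otimes> q t \<in> Q" using pq rest by (simp add: minus_eq Q.a_closed Q.a_inv_closed)
  then show False using s t p q Q.I_prime mpoly_coeff_closed by blast
qed

lemma mpoly_const_dvdI:
  assumes c: "c \<in> carrier R" and P: "P \<in> (carrier R)[\<X>\<^bsub>I\<^esub>]" and dvd: "\<And>m. P m \<in> PIdl c"
  obtains Q where "Q \<in> (carrier R)[\<X>\<^bsub>I\<^esub>]" "P = mpoly_mult R Q (indexed_const c)"
proof -
  have "\<exists>d. d \<in> carrier R \<and> P m = d \<otimes> c \<and> (P m = \<zero> \<longrightarrow> d = \<zero>)" for m
  proof (cases "P m = \<zero>")
    case False
    then show ?thesis using dvd[of m] by (auto simp: cgenideal_def)
  qed (use c in \<open>auto intro!: exI[of _ \<zero>]\<close>)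
  \<comment> \<open>The value \<open>\<zero>\<close> off the support of \<open>P\<close> keeps the support of the quotient finite.\<close>
  then obtain Q where Q: "\<And>m. Q m \<in> carrier R" "\<And>m. P m = Q m \<otimes> c" "\<And>m. P m = \<zero> \<Longrightarrow> Q m = \<zero>"
    by metis
  have nz: "P m \<noteq> \<zero>" if "Q m \<noteq> \<zero>" for m using Q(3) that by blast
  have "Q \<in> (carrier R)[\<X>\<^bsub>I\<^esub>]"
  proof (rule mpoly_memI)
    show "finite {m. Q m \<noteq> \<zero>}"
      by (rule finite_subset[OF _ mpoly_finite_support[OF P]]) (use nz in auto)
  qed (use Q(1) nz mpoly_support_vars[OF P] in \<open>auto simp: carrier_coeff_def\<close>)
  moreover have "P = mpoly_mult R Q (indexed_const c)"
    using Q c by (auto simp: mpoly_mult_const carrier_coeff_def)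
  ultimately show thesis by (rule that)
qed

end

context domain
begin

lemma mpoly_ring_domain:
  fixes I :: "'c::linorder set"
  shows "domain (mpoly_ring R I)"
proof -
  interpret S: cring "mpoly_ring R I" by (rule mpoly_ring_cring)
  show ?thesis
  proof
    show "\<one>\<^bsub>mpoly_ring R I\<^esub> \<noteq> \<zero>\<^bsub>mpoly_ring R I\<^esub>"
      by (auto simp: indexed_const_def dest: fun_cong[of _ _ "{#}"])
  next
    fix p q
    assume pq: "p \<otimes>\<^bsub>mpoly_ring R I\<^esub> q = \<zero>\<^bsub>mpoly_ring R I\<^esub>"
      "p \<in> carrier (mpoly_ring R I)" "q \<in> carrier (mpoly_ring R I)"
    then have "(\<forall>m. p m \<in> {\<zero>}) \<or> (\<forall>m. q m \<in> {\<zero>})"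
      by (intro mpoly_mult_coeffs_in_primeideal[OF zeroprimeideal]) (auto simp: indexed_zero_def)
    then show "p = \<zero>\<^bsub>mpoly_ring R I\<^esub> \<or> q = \<zero>\<^bsub>mpoly_ring R I\<^esub>"
      by (auto simp: indexed_zero_def)
  qed
qed

text \<open>
  If \<open>F = a T\<^sub>k + g\<close> with \<open>a \<noteq> 0\<close> and \<open>g\<close> free of \<open>T\<^sub>k\<close>, multiplication by \<open>F\<close> raises the
  degree in \<open>T\<^sub>k\<close> by one: for a monomial \<open>m\<close> of \<open>H\<close> of maximal degree in \<open>T\<^sub>k\<close>, the coefficient of
  \<open>F H\<close> at \<open>m T\<^sub>k\<close> is \<open>a H\<^sub>m\<close>. So no nonzero multiple of \<open>F\<close> is free of \<open>T\<^sub>k\<close>.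
\<close>
lemma mpoly_linear_multiple:
  assumes F: "F \<in> (carrier R)[\<X>\<^bsub>I\<^esub>]" and lc: "F {#k#} \<noteq> \<zero>"
    and lin: "\<And>m. k \<in># m \<Longrightarrow> m \<noteq> {#k#} \<Longrightarrow> F m = \<zero>"
    and H: "H \<in> (carrier R)[\<X>\<^bsub>I\<^esub>]" and FH: "mpoly_mult R F H \<in> (carrier R)[\<X>\<^bsub>I - {k}\<^esub>]"
  shows "H = indexed_const \<zero>"
proof (rule ccontr)
  assume "H \<noteq> indexed_const \<zero>"
  then have ne: "{m. H m \<noteq> \<zero>} \<noteq> {}" by (auto simp: indexed_zero_def)
  have fin: "finite ((\<lambda>m. count m k) ` {m. H m \<noteq> \<zero>})" using mpoly_finite_support[OF H] by blast
  obtain m where m: "H m \<noteq> \<zero>" and max: "\<And>m'. H m' \<noteq> \<zero> \<Longrightarrow> count m' k \<le> count m k"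
    using Max_in[OF fin] Max_ge[OF fin] ne by auto
  have "mpoly_mult R F H (add_mset k m) = (\<Oplus>b\<in>{{#k#}}. F {#k#} \<otimes> H m)"
    unfolding mpoly_mult_def
  proof (intro add.finprod_mono_neutral_cong_right finite_submultisets)
    fix b assume "b \<in> {a. a \<subseteq># add_mset k m} - {{#k#}}"
    show "F b \<otimes> H (add_mset k m - b) = \<zero>"
    proof (cases "k \<in># b")
      case True
      then have "F b = \<zero>" using lin \<open>b \<in> _\<close> by auto
      then show ?thesis using H by (simp add: mpoly_coeff_closed)
    next
      case False
      then have "count (add_mset k m - b) k = Suc (count m k)" using count_eq_zero_iff[of b k] by simp
      then have "H (add_mset k m - b) = \<zero>" using max by fastforce
      then show ?thesis using F by (simp add: mpoly_coeff_closed)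
    qed
  qed (use F H in \<open>auto simp: mpoly_coeff_closed\<close>)
  also have "\<dots> = F {#k#} \<otimes> H m" using F H by (simp add: mpoly_coeff_closed)
  also have "\<dots> \<noteq> \<zero>" using lc m F H integral_iff mpoly_coeff_closed by blast
  finally show False using mpoly_support_vars[OF FH] by force
qed

end

section \<open>Prime elements and heights in factorial domains\<close>

context factorial_domain
begin

text \<open>
  Unique factorization as an induction principle, which replaces explicit lists of irreducible
  factors in the arguments below.
\<close>
lemma prime_factor_induct [consumes 2, case_names unit prime_mult]:
  assumes "a \<in> carrier R" "a \<noteq> \<zero>"
    and unit: "\<And>u. u \<in> Units R \<Longrightarrow> P u"
    and prime_mult: "\<And>p b. \<lbrakk>p \<in> carrier R; ring_prime p; b \<in> carrier R; b \<noteq> \<zero>; P b\<rbrakk> \<Longrightarrow> P (p \<otimes> b)"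
  shows "P a"
proof -
  have step: "P (u \<otimes> foldr (\<otimes>) fs \<one>)"
    if "u \<in> Units R" "\<forall>p\<in>set fs. p \<in> carrier (mult_of R) \<and> irreducible (mult_of R) p" for u fs
    using that
  proof (induction fs)
    case Nil
    then have "u \<otimes> foldr (\<otimes>) [] \<one> = u" by (simp add: Units_closed)
    then show ?case using unit[OF \<open>u \<in> Units R\<close>] by (simp only:)
  next
    case (Cons p fs)
    let ?b = "u \<otimes> foldr (\<otimes>) fs \<one>"
    have prod: "foldr (\<otimes>) fs \<one> \<in> carrier R - {\<zero>}"
      using Cons.prems(2) mult_of.multlist_closed[of fs] by auto
    have "u \<in> carrier R - {\<zero>}"
      using Cons.prems(1) mult_of.Units_closed[of u] by simp
    then have u: "u \<in> carrier R" "u \<noteq> \<zero>" by auto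
    have p: "p \<in> carrier R" "p \<noteq> \<zero>" "prime (mult_of R) p"
      using Cons.prems(2) irreducible_prime[of p] by auto
    then have prime: "ring_prime p" by (simp add: ring_prime_def prime_eq_prime_mult)
    have "P ?b" by (rule Cons.IH) (use Cons.prems in auto)
    moreover have "?b \<in> carrier R" "?b \<noteq> \<zero>" using u prod integral_iff[of u] by auto
    ultimately have "P (p \<otimes> ?b)" by (rule prime_mult[OF p(1) prime, rotated 2])
    moreover have "p \<otimes> ?b = u \<otimes> foldr (\<otimes>) (p # fs) \<one>" using p u prod by (simp add: m_lcomm)
    ultimately show ?case by (simp only:)
  qed
  have "\<exists>fs u. a = u \<otimes> foldr (\<otimes>) fs \<one> \<and> u \<in> Units R
      \<and> (\<forall>p\<in>set fs. p \<in> carrier (mult_of R) \<and> irreducible (mult_of R) p)"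
  proof -
    obtain fs where fs: "set fs \<subseteq> carrier (mult_of R)" "wfactors (mult_of R) fs a"
      using wfactors_exist[of a] assms(1,2) by auto
    have prod: "foldr (\<otimes>) fs \<one> \<in> carrier R - {\<zero>}"
      using fs(1) mult_of.multlist_closed[of fs] by auto
    have "foldr (\<otimes>) fs \<one> \<sim>\<^bsub>mult_of R\<^esub> a" using fs(2) by (simp add: wfactors_def)
    then have "foldr (\<otimes>) fs \<one> \<sim> a"
      using prod assms(1) assoc_iff_assoc_mult by blast
    then have "a \<sim> foldr (\<otimes>) fs \<one>" by (simp add: associated_def)
    then obtain u where "u \<in> Units R" "a = u \<otimes> foldr (\<otimes>) fs \<one>"
      using prod assms(1) ring_associated_iff by blast
    then show ?thesis using fs by (auto simp: wfactors_def)
  qed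
  then show ?thesis using step by blast
qed

lemma ring_prime_primeideal: "p \<in> carrier R \<Longrightarrow> ring_prime p \<Longrightarrow> primeideal (PIdl p) R"
  using primeideal_iff_prime[of p] by (auto simp: ring_prime_def)

lemma primeideal_contains_prime:
  assumes "primeideal P R" "a \<in> P" "a \<noteq> \<zero>"
  obtains p where "p \<in> P" "ring_prime p"
proof -
  interpret P: primeideal P R by fact
  have "a \<in> P \<longrightarrow> (\<exists>p\<in>P. ring_prime p)"
    using P.Icarr[OF assms(2)] assms(3)
  proof (induction rule: prime_factor_induct)
    case (unit u)
    have "u \<notin> P"
    proof
      assume "u \<in> P"
      then have "PIdl u \<subseteq> P" by (rule cgenideal_minimal[OF P.is_ideal])
      moreover have "carrier R = PIdl u" using unit ideal_eq_carrier_iff[OF Units_closed] by simp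
      ultimately show False using P.I_notcarr P.a_subset by (metis subset_antisym)
    qed
    then show ?case by simp
  next
    case (prime_mult p b)
    then show ?case using P.I_prime by blast
  qed
  then show thesis using assms(2) that by blast
qed

text \<open>
  A nonzero prime ideal \<open>Q\<close> inside \<open>(p)\<close> contains a prime element \<open>q\<close>. It is a multiple of \<open>p\<close>,
  hence an associate of \<open>p\<close>, and \<open>Q\<close> is all of \<open>(p)\<close>.
\<close>
lemma primeideal_below_prime:
  assumes "p \<in> carrier R" "ring_prime p" "primeideal Q R" "Q \<subset> PIdl p"
  shows "Q = {\<zero>}"
proof (rule ccontr)
  interpret Q: primeideal Q R by fact
  assume "Q \<noteq> {\<zero>}"
  then obtain a where "a \<in> Q" "a \<noteq> \<zero>" using Q.zero_closed by blast
  then obtain q where q: "q \<in> Q" "ring_prime q" by (rule primeideal_contains_prime[OF \<open>primeideal Q R\<close>])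
  have qc: "q \<in> carrier R" using q Q.Icarr by blast
  obtain s where s: "s \<in> carrier R" "q = s \<otimes> p"
    using q(1) assms(4) by (auto simp: cgenideal_def)
  have "ring_irreducible q"
    using q(2) qc by (auto simp: ring_prime_def prime_eq_prime_mult intro!: ring_irreducibleI' mult_of.prime_irreducible)
  then have "s \<in> Units R \<or> p \<in> Units R" using ring_irreducibleE(5)[OF qc _ s(1) assms(1) s(2)] by blast
  moreover have "p \<notin> Units R"
    using assms(2) by (auto simp: ring_prime_def prime_def)
  ultimately have "s \<in> Units R" by blast
  then have "p = inv s \<otimes> q" using s assms(1) by (simp add: m_assoc[symmetric])
  then have "p \<in> Q" using \<open>s \<in> Units R\<close> q(1) Q.I_l_closed by auto
  then have "PIdl p \<subseteq> Q" by (rule cgenideal_minimal[OF Q.is_ideal])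
  then show False using assms(4) by blast
qed

text \<open>
  If \<open>J \<subseteq> (p)\<close>, then \<open>(p)\<close> is a prime ideal of height at most one above \<open>J\<close>. If \<open>J\<close> lies in no
  such ideal, then below a prime ideal \<open>P \<supseteq> J\<close> there is the chain \<open>0 \<subset> (p) \<subset> P\<close>, where \<open>p \<in> P\<close> is
  a prime factor of a nonzero element of \<open>J\<close>.
\<close>
lemma ideal_height_ge_2_iff:
  assumes "ideal J R" "J \<noteq> {\<zero>}"
  shows "J = carrier R \<or> ideal_height R J \<ge> 2 \<longleftrightarrow> (\<forall>p\<in>carrier R. ring_prime p \<longrightarrow> \<not> J \<subseteq> PIdl p)"
proof -
  interpret J: ideal J R by fact
  have low: "prime_height R (PIdl p) \<le> 1" if p: "p \<in> carrier R" "ring_prime p" for p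
    unfolding prime_height_def
  proof (rule SUP_least, clarify)
    fix k Q
    assume Q: "\<forall>i\<le>k. primeideal (Q i) R" "\<forall>i<k. Q i \<subset> Q (Suc i)" "Q k = PIdl p"
    show "enat k \<le> 1"
    proof (rule ccontr)
      assume "\<not> enat k \<le> 1"
      then obtain j where k: "k = Suc (Suc j)"
        by (metis One_nat_def enat_ord_simps(1) le_Suc_eq not0_implies_Suc one_enat_def zero_le)
      have "Q (Suc j) \<subset> PIdl p" "Q j \<subset> Q (Suc j)" using Q k by auto
      moreover from this have "Q (Suc j) = {\<zero>}"
        using primeideal_below_prime[OF p] Q(1) k by auto
      moreover have "\<zero> \<in> Q j"
        using Q(1) k primeideal.axioms(1)[of "Q j" R] ideal.axioms(1) additive_subgroup.zero_closed
        by fastforce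
      ultimately show False by (metis psubset_eq subset_singletonD empty_iff)
    qed
  qed
  have high: "prime_height R P \<ge> 2"
    if P: "primeideal P R" "J \<subseteq> P" and nodvd: "\<forall>p\<in>carrier R. ring_prime p \<longrightarrow> \<not> J \<subseteq> PIdl p" for P
  proof -
    interpret P: primeideal P R by fact
    obtain a where a: "a \<in> J" "a \<noteq> \<zero>" using assms(2) J.zero_closed by blast
    then obtain p where p: "p \<in> P" "ring_prime p"
      using primeideal_contains_prime[OF P(1), of a] P(2) by blast
    have pc: "p \<in> carrier R" "p \<noteq> \<zero>" using p P.Icarr by (auto simp: ring_prime_def)
    have p_in: "p \<in> PIdl p" using cgenideal_self[OF pc(1)] .
    have ps: "PIdl p \<subseteq> P" using p(1) by (rule cgenideal_minimal[OF P.is_ideal])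
    have neP: "PIdl p \<noteq> P" using nodvd p(2) pc P(2) by blast
    define Q where "Q = (\<lambda>i::nat. if i = 0 then {\<zero>} else if i = 1 then PIdl p else P)"
    have "\<forall>i\<le>2. primeideal (Q i) R"
      using zeroprimeideal ring_prime_primeideal[OF pc(1) p(2)] P(1) by (simp add: Q_def)
    moreover have "Q i \<subset> Q (Suc i)" if "i < 2" for i
    proof -
      have "i = 0 \<or> i = 1" using that by linarith
      moreover have "\<zero> \<in> PIdl p"
        using additive_subgroup.zero_closed[OF ideal.axioms(1)[OF cgenideal_ideal[OF pc(1)]]] .
      ultimately show ?thesis using ps neP p_in pc(2) by (auto simp: Q_def)
    qed
    moreover have "Q 2 = P" by (simp add: Q_def)
    ultimately have "enat 2 \<le> prime_height R P"
      unfolding prime_height_def by (intro SUP_upper) blast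
    then show ?thesis by (simp add: numeral_eq_enat)
  qed
  show ?thesis
  proof
    assume asm: "J = carrier R \<or> ideal_height R J \<ge> 2"
    show "\<forall>p\<in>carrier R. ring_prime p \<longrightarrow> \<not> J \<subseteq> PIdl p"
    proof (intro ballI impI notI)
      fix p assume p: "p \<in> carrier R" "ring_prime p" "J \<subseteq> PIdl p"
      interpret p: primeideal "PIdl p" R by (rule ring_prime_primeideal[OF p(1,2)])
      have "J \<noteq> carrier R" using p(3) p.I_notcarr p.a_subset by blast
      then have "2 \<le> ideal_height R J" using asm by blast
      also have "\<dots> \<le> prime_height R (PIdl p)"
        unfolding ideal_height_def using p.primeideal p(3) by (intro INF_lower) blast
      also have "\<dots> \<le> 1" by (rule low[OF p(1,2)])
      finally show False by (simp add: one_enat_def numeral_eq_enat)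
    qed
  next
    assume "\<forall>p\<in>carrier R. ring_prime p \<longrightarrow> \<not> J \<subseteq> PIdl p"
    then have "ideal_height R J \<ge> 2"
      unfolding ideal_height_def using high by (intro INF_greatest) blast
    then show "J = carrier R \<or> ideal_height R J \<ge> 2" ..
  qed
qed

end

section \<open>Elimination of a variable and quotients by linear polynomials\<close>

context cring
begin

lemma indexed_var_mem: "i \<in> I \<Longrightarrow> indexed_var i \<in> (carrier R)[\<X>\<^bsub>I\<^esub>]"
  unfolding indexed_var_def by (intro indexed_pset.intros) auto

lemma mpoly_mult_var:
  assumes "P \<in> (carrier R)[\<X>\<^bsub>I\<^esub>]"
  shows "mpoly_mult R P (indexed_var i) = indexed_pmult P i"
  using assms unfolding indexed_var_def
  by (simp add: mpoly_mult_pmult mpoly_carrier_coeff mpoly_mult_one)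

lemma mpoly_mono:
  assumes "I \<subseteq> I'" "P \<in> (carrier R)[\<X>\<^bsub>I\<^esub>]" shows "P \<in> (carrier R)[\<X>\<^bsub>I'\<^esub>]"
  using assms(2) by induction (use assms(1) in \<open>auto intro: indexed_pset.intros\<close>)

text \<open>
  Denominators are cleared by induction on the construction of \<open>G\<close>. The map \<open>h\<close> stands for the
  projection to a quotient in which \<open>a T\<^sub>k = g\<close>: a factor \<open>T\<^sub>k\<close> costs one more power of \<open>a\<close> and is
  replaced by \<open>g\<close>.
\<close>
lemma eliminate_variable:
  assumes "ring_hom_cring (mpoly_ring R I) A h" and k: "k \<in> I"
    and a: "a \<in> carrier R" and g: "g \<in> (carrier R)[\<X>\<^bsub>I - {k}\<^esub>]"
    and solve: "h (indexed_const a) \<otimes>\<^bsub>A\<^esub> h (indexed_var k) = h g"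
    and G: "G \<in> (carrier R)[\<X>\<^bsub>I\<^esub>]"
  shows "\<exists>d::nat. \<exists>H\<in>(carrier R)[\<X>\<^bsub>I - {k}\<^esub>]. h (indexed_const a) [^]\<^bsub>A\<^esub> d \<otimes>\<^bsub>A\<^esub> h G = h H"
proof -
  interpret h: ring_hom_cring "mpoly_ring R I" A h by fact
  let ?B = "(carrier R)[\<X>\<^bsub>I - {k}\<^esub>]" and ?y = "h (indexed_const a)"
  have sub: "P \<in> (carrier R)[\<X>\<^bsub>I\<^esub>]" if "P \<in> ?B" for P by (rule mpoly_mono[OF _ that]) blast
  have h_closed: "h P \<in> carrier A" if "P \<in> (carrier R)[\<X>\<^bsub>I\<^esub>]" for P
    using h.hom_closed[of P] that by simp
  have h_mult: "h (mpoly_mult R P Q) = h P \<otimes>\<^bsub>A\<^esub> h Q"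
    if "P \<in> (carrier R)[\<X>\<^bsub>I\<^esub>]" "Q \<in> (carrier R)[\<X>\<^bsub>I\<^esub>]" for P Q
    using h.hom_mult[of P Q] that by simp
  have h_padd: "h (indexed_padd P Q) = h P \<oplus>\<^bsub>A\<^esub> h Q"
    if "P \<in> (carrier R)[\<X>\<^bsub>I\<^esub>]" "Q \<in> (carrier R)[\<X>\<^bsub>I\<^esub>]" for P Q
    using h.hom_add[of P Q] that by simp
  have const_B: "indexed_const a \<in> ?B" using a by (rule indexed_pset.indexed_const)
  have y: "?y \<in> carrier A" using h_closed sub const_B by blast
  have pow: "\<exists>C\<in>?B. h C = ?y [^]\<^bsub>A\<^esub> (d::nat)" for d
  proof (induction d)
    case 0
    have "indexed_const \<one> \<in> ?B" by (rule indexed_pset.indexed_const) simp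
    then show ?case using h.hom_one by (auto intro!: bexI[of _ "indexed_const \<one>"])
  next
    case (Suc d)
    then obtain C where "C \<in> ?B" "h C = ?y [^]\<^bsub>A\<^esub> d" by blast
    then show ?case using const_B sub
      by (intro bexI[of _ "mpoly_mult R C (indexed_const a)"]) (simp_all add: h_mult mpoly_mult_closed)
  qed
  show ?thesis using G
  proof induction
    case (indexed_const c)
    then have "indexed_const c \<in> ?B" by (rule indexed_pset.indexed_const)
    then show ?case
      using h_closed[OF sub] by (intro exI[of _ 0] bexI[of _ "indexed_const c"]) auto
  next
    case (indexed_padd P Q)
    then obtain d e :: nat and HP HQ where H: "HP \<in> ?B" "HQ \<in> ?B"
      "?y [^]\<^bsub>A\<^esub> d \<otimes>\<^bsub>A\<^esub> h P = h HP" "?y [^]\<^bsub>A\<^esub> e \<otimes>\<^bsub>A\<^esub> h Q = h HQ" by blast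
    obtain CP CQ where C: "CP \<in> ?B" "CQ \<in> ?B" "h CP = ?y [^]\<^bsub>A\<^esub> d" "h CQ = ?y [^]\<^bsub>A\<^esub> e"
      using pow by metis
    have cl: "h P \<in> carrier A" "h Q \<in> carrier A" "?y [^]\<^bsub>A\<^esub> d \<in> carrier A" "?y [^]\<^bsub>A\<^esub> e \<in> carrier A"
      using indexed_padd.hyps h_closed y by auto
    have "?y [^]\<^bsub>A\<^esub> (d + e) \<otimes>\<^bsub>A\<^esub> h (indexed_padd P Q)
        = ?y [^]\<^bsub>A\<^esub> e \<otimes>\<^bsub>A\<^esub> (?y [^]\<^bsub>A\<^esub> d \<otimes>\<^bsub>A\<^esub> h P) \<oplus>\<^bsub>A\<^esub> ?y [^]\<^bsub>A\<^esub> d \<otimes>\<^bsub>A\<^esub> (?y [^]\<^bsub>A\<^esub> e \<otimes>\<^bsub>A\<^esub> h Q)"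
      using cl y indexed_padd.hyps
      by (simp add: h_padd h.S.nat_pow_mult[symmetric] h.S.r_distr h.S.l_distr h.S.m_ac)
    also have "\<dots> = h (indexed_padd (mpoly_mult R CQ HP) (mpoly_mult R CP HQ))"
      using H C by (simp add: h_padd h_mult sub mpoly_mult_closed)
    finally show ?case
      using H C by (intro exI[of _ "d + e"] bexI[of _ "indexed_padd (mpoly_mult R CQ HP) (mpoly_mult R CP HQ)"])
        (auto intro: indexed_pset.indexed_padd mpoly_mult_closed)
  next
    case (indexed_pmult P i)
    then obtain d :: nat and H where H: "H \<in> ?B" "?y [^]\<^bsub>A\<^esub> d \<otimes>\<^bsub>A\<^esub> h P = h H" by blast
    have i: "h (indexed_pmult P i) = h P \<otimes>\<^bsub>A\<^esub> h (indexed_var i)"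
      using indexed_pmult.hyps by (simp add: mpoly_mult_var[symmetric] h_mult indexed_var_mem)
    have cl: "h P \<in> carrier A" "h (indexed_var i) \<in> carrier A" "?y [^]\<^bsub>A\<^esub> d \<in> carrier A"
      using indexed_pmult.hyps h_closed y by (auto simp: indexed_var_mem)
    have eq: "?y [^]\<^bsub>A\<^esub> d \<otimes>\<^bsub>A\<^esub> h (indexed_pmult P i) = h H \<otimes>\<^bsub>A\<^esub> h (indexed_var i)"
      using cl by (simp add: i H(2)[symmetric] h.S.m_assoc)
    show ?case
    proof (cases "i = k")
      case False
      then have "indexed_var i \<in> ?B" using indexed_pmult.hyps by (intro indexed_var_mem) auto
      then show ?thesis using eq H(1)
        by (intro exI[of _ d] bexI[of _ "mpoly_mult R H (indexed_var i)"])
           (auto simp: h_mult sub intro: mpoly_mult_closed)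
    next
      case True
      have "?y [^]\<^bsub>A\<^esub> Suc d \<otimes>\<^bsub>A\<^esub> h (indexed_pmult P i) = ?y \<otimes>\<^bsub>A\<^esub> (?y [^]\<^bsub>A\<^esub> d \<otimes>\<^bsub>A\<^esub> h (indexed_pmult P i))"
        using cl y by (simp add: i h.S.m_ac)
      also have "\<dots> = ?y \<otimes>\<^bsub>A\<^esub> (h H \<otimes>\<^bsub>A\<^esub> h (indexed_var k))" by (simp only: eq[unfolded True] True)
      also have "\<dots> = h H \<otimes>\<^bsub>A\<^esub> (?y \<otimes>\<^bsub>A\<^esub> h (indexed_var k))"
        using cl[unfolded True] y h_closed[OF sub[OF H(1)]] by (simp add: h.S.m_lcomm)
      also have "\<dots> = h (mpoly_mult R H g)" using H(1) g by (simp add: solve h_mult sub)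
      finally show ?thesis using H(1) g
        by (intro exI[of _ "Suc d"] bexI[of _ "mpoly_mult R H g"]) (auto intro: mpoly_mult_closed)
    qed
  qed
qed

end

context factorial_domain
begin

text \<open>
  A nonzero constant is a nonzerodivisor modulo a primitive polynomial. Units are harmless. For a
  prime \<open>p\<close>, an equation \<open>E p = H F\<close> puts all coefficients of \<open>H F\<close> into \<open>(p)\<close>; those of \<open>F\<close> are
  not all there, so by Gauss's lemma \<open>H = Q p\<close>, and cancelling \<open>p\<close> leaves \<open>E = Q F\<close>.
\<close>
lemma mpoly_cancel_const:
  fixes F G :: "'c::linorder multiset \<Rightarrow> 'a"
  assumes F: "F \<in> (carrier R)[\<X>\<^bsub>I\<^esub>]"
    and primitive: "\<And>p. p \<in> carrier R \<Longrightarrow> ring_prime p \<Longrightarrow> \<exists>m. F m \<notin> PIdl p"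
    and "a \<in> carrier R" "a \<noteq> \<zero>"
    and "G \<in> (carrier R)[\<X>\<^bsub>I\<^esub>]" and "mpoly_mult R (indexed_const a) G \<in> PIdl\<^bsub>mpoly_ring R I\<^esub> F"
  shows "G \<in> PIdl\<^bsub>mpoly_ring R I\<^esub> F"
proof -
  interpret S: domain "mpoly_ring R I" by (rule mpoly_ring_domain)
  let ?J = "PIdl\<^bsub>mpoly_ring R I\<^esub> F"
  interpret J: ideal ?J "mpoly_ring R I" using F by (intro S.cgenideal_ideal) simp
  have const: "indexed_const c \<in> (carrier R)[\<X>\<^bsub>I\<^esub>]" if "c \<in> carrier R" for c
    using that by (rule indexed_pset.indexed_const)
  have const_mult: "mpoly_mult R (indexed_const (c \<otimes> d)) P
      = mpoly_mult R (indexed_const c) (mpoly_mult R (indexed_const d) P)"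
    if "c \<in> carrier R" "d \<in> carrier R" "P \<in> (carrier R)[\<X>\<^bsub>I\<^esub>]" for c d and P :: "'c multiset \<Rightarrow> 'a"
  proof -
    have "(indexed_const (c \<otimes> d) :: 'c multiset \<Rightarrow> 'a) = mpoly_mult R (indexed_const c) (indexed_const d)"
      using that by (subst mpoly_mult_const[OF carrier_coeff_const]) (auto simp: indexed_const_def)
    then show ?thesis using that by (simp add: mpoly_mult_assoc)
  qed
  have "\<forall>G\<in>(carrier R)[\<X>\<^bsub>I\<^esub>]. mpoly_mult R (indexed_const a) G \<in> ?J \<longrightarrow> G \<in> ?J"
    using assms(3,4)
  proof (induction rule: prime_factor_induct)
    case (unit u)
    show ?case
    proof (intro ballI impI)
      fix G assume G: "G \<in> (carrier R)[\<X>\<^bsub>I\<^esub>]" "mpoly_mult R (indexed_const u) G \<in> ?J"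
      have "mpoly_mult R (indexed_const (inv u)) (mpoly_mult R (indexed_const u) G) \<in> ?J"
        using J.I_l_closed[OF G(2), of "indexed_const (inv u)"] unit const by simp
      also have "mpoly_mult R (indexed_const (inv u)) (mpoly_mult R (indexed_const u) G) = G"
        using unit G S.l_one[of G] by (simp add: const_mult[symmetric] Units_closed)
      finally show "G \<in> ?J" .
    qed
  next
    case (prime_mult p b)
    show ?case
    proof (intro ballI impI)
      fix G assume G: "G \<in> (carrier R)[\<X>\<^bsub>I\<^esub>]" "mpoly_mult R (indexed_const (p \<otimes> b)) G \<in> ?J"
      define E where "E = mpoly_mult R (indexed_const b) G"
      have E: "E \<in> (carrier R)[\<X>\<^bsub>I\<^esub>]"
        unfolding E_def using const prime_mult G by (intro mpoly_mult_closed) auto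
      have pE: "mpoly_mult R E (indexed_const p) = mpoly_mult R (indexed_const (p \<otimes> b)) G"
        using prime_mult G(1) E mpoly_carrier_coeff[OF E]
        by (simp add: mpoly_mult_comm[of E] const_mult E_def[symmetric])
      then obtain H where H: "H \<in> (carrier R)[\<X>\<^bsub>I\<^esub>]" "mpoly_mult R E (indexed_const p) = mpoly_mult R H F"
        using G(2) by (auto simp: cgenideal_def)
      interpret p: primeideal "PIdl p" R by (rule ring_prime_primeideal[OF prime_mult(1,2)])
      have "mpoly_mult R H F m \<in> PIdl p" for m
      proof -
        have "mpoly_mult R H F m = E m \<otimes> p"
          using prime_mult(1) E by (simp add: H(2)[symmetric] mpoly_mult_const mpoly_carrier_coeff)
        then show ?thesis using mpoly_coeff_closed[OF E] unfolding cgenideal_def by blast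
      qed
      then have "\<forall>m. H m \<in> PIdl p"
        using mpoly_mult_coeffs_in_primeideal[OF p.primeideal H(1) F] primitive[OF prime_mult(1,2)] by blast
      then obtain Q where Q: "Q \<in> (carrier R)[\<X>\<^bsub>I\<^esub>]" "H = mpoly_mult R Q (indexed_const p)"
        using mpoly_const_dvdI[OF prime_mult(1) H(1)] by blast
      have car: "Q \<in> carrier (mpoly_ring R I)" "F \<in> carrier (mpoly_ring R I)" "indexed_const p \<in> carrier (mpoly_ring R I)"
        using Q(1) F const[OF prime_mult(1)] by simp_all
      have "(Q \<otimes>\<^bsub>mpoly_ring R I\<^esub> indexed_const p) \<otimes>\<^bsub>mpoly_ring R I\<^esub> F
          = (Q \<otimes>\<^bsub>mpoly_ring R I\<^esub> F) \<otimes>\<^bsub>mpoly_ring R I\<^esub> indexed_const p"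
        using car by (simp only: S.m_ac S.m_closed)
      then have "E \<otimes>\<^bsub>mpoly_ring R I\<^esub> indexed_const p
          = (Q \<otimes>\<^bsub>mpoly_ring R I\<^esub> F) \<otimes>\<^bsub>mpoly_ring R I\<^esub> indexed_const p"
        using H(2) Q(2) by simp
      moreover have "indexed_const p \<noteq> \<zero>\<^bsub>mpoly_ring R I\<^esub>"
        using prime_mult(2) by (auto simp: ring_prime_def indexed_const_def dest: fun_cong[of _ _ "{#}"])
      moreover have "Q \<otimes>\<^bsub>mpoly_ring R I\<^esub> F \<in> carrier (mpoly_ring R I)" using Q F by (simp add: mpoly_mult_closed)
      ultimately have "E = Q \<otimes>\<^bsub>mpoly_ring R I\<^esub> F"
        using E const[OF prime_mult(1)] S.m_rcancel[of "indexed_const p" E "Q \<otimes>\<^bsub>mpoly_ring R I\<^esub> F"] by simp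
      then have "E \<in> ?J" using Q by (auto simp: cgenideal_def)
      then show "G \<in> ?J" using prime_mult.IH G(1) by (simp add: E_def)
    qed
  qed
  then show ?thesis using assms(5,6) by blast
qed

text \<open>
  For classes \<open>u\<close> and \<open>v\<close> with \<open>u v = 0\<close>, suitable \<open>a\<^sup>d u\<close> and \<open>a\<^sup>e v\<close> are represented by polynomials
  free of \<open>T\<^sub>k\<close> whose product is a multiple of \<open>F\<close> free of \<open>T\<^sub>k\<close>, hence zero. So one of the two
  polynomials vanishes, and the power of \<open>a\<close> can be cancelled in the quotient.
\<close>
lemma linear_primitive_quotient_domain:
  fixes F :: "'c::linorder multiset \<Rightarrow> 'a"
  assumes F: "F \<in> (carrier R)[\<X>\<^bsub>I\<^esub>]" and k: "k \<in> I" and lc: "F {#k#} \<noteq> \<zero>"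
    and lin: "\<And>m. k \<in># m \<Longrightarrow> m \<noteq> {#k#} \<Longrightarrow> F m = \<zero>"
    and primitive: "\<And>p. p \<in> carrier R \<Longrightarrow> ring_prime p \<Longrightarrow> \<exists>m. F m \<notin> PIdl p"
  shows "domain (mpoly_ring R I Quot PIdl\<^bsub>mpoly_ring R I\<^esub> F)"
proof -
  interpret S: domain "mpoly_ring R I" by (rule mpoly_ring_domain)
  let ?S = "mpoly_ring R I"
  let ?J = "PIdl\<^bsub>?S\<^esub> F"
  interpret J: ideal ?J ?S using F by (intro S.cgenideal_ideal) simp
  define h where "h = (\<lambda>P. ?J +>\<^bsub>?S\<^esub> P)"
  interpret h: ring_hom_cring ?S "?S Quot ?J" h
    unfolding h_def by (rule J.rcos_ring_hom_cring[OF S.is_cring])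
  have h_zero: "h P = \<zero>\<^bsub>?S Quot ?J\<^esub> \<longleftrightarrow> P \<in> ?J" if "P \<in> carrier ?S" for P
    unfolding h_def FactRing_def using that
    by (simp add: J.a_rcos_const J.rcos_const_imp_mem) (metis J.rcos_const_imp_mem J.a_rcos_const that)
  define a where "a = F {#k#}"
  have a: "a \<in> carrier R" "a \<noteq> \<zero>" using F lc by (auto simp: a_def mpoly_coeff_closed)
  have a_S: "indexed_const a \<in> carrier ?S" using a(1) by (simp add: indexed_pset.indexed_const)
  \<comment> \<open>The polynomial \<open>g = a T\<^sub>k - F\<close>, which has the same image as \<open>a T\<^sub>k\<close> modulo \<open>F\<close>.\<close>
  define g where "g = (\<lambda>m. if m = {#k#} then \<zero> else \<ominus> F m)"
  have Fz: "F m \<noteq> \<zero>" if "g m \<noteq> \<zero>" for m using that by (auto simp: g_def split: if_splits)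
  have g: "g \<in> (carrier R)[\<X>\<^bsub>I - {k}\<^esub>]"
  proof (rule mpoly_memI)
    show "finite {m. g m \<noteq> \<zero>}"
      by (rule finite_subset[OF _ mpoly_finite_support[OF F]]) (use Fz in auto)
    show "set_mset m \<subseteq> I - {k}" if "g m \<noteq> \<zero>" for m
    proof -
      have "k \<notin># m" using that lin[of m] by (auto simp: g_def split: if_splits)
      then show ?thesis using mpoly_support_vars[OF F Fz[OF that]] by blast
    qed
  qed (use F in \<open>auto simp: g_def carrier_coeff_def mpoly_coeff_closed\<close>)
  have gS: "g \<in> carrier ?S" using mpoly_mono[OF _ g, of I] by auto
  have var: "indexed_var k \<in> carrier ?S" using k by (simp add: indexed_var_mem)
  have single: "m = {#k#}" if "k \<in># m" "m - {#k#} = {#}" for m using insert_DiffM[OF that(1)] that(2) by simp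
  have "indexed_const a \<otimes>\<^bsub>?S\<^esub> indexed_var k = indexed_padd F g"
    using F a_S by (auto dest: single simp: mpoly_mult_var indexed_padd_def indexed_pmult_def indexed_const_def g_def a_def
        mpoly_coeff_closed r_neg fun_eq_iff)
  then have "h (indexed_const a) \<otimes>\<^bsub>?S Quot ?J\<^esub> h (indexed_var k) = h F \<oplus>\<^bsub>?S Quot ?J\<^esub> h g"
    using h.hom_mult[OF a_S var] h.hom_add[of F g] F gS by simp
  also have "h F = \<zero>\<^bsub>?S Quot ?J\<^esub>" using F S.cgenideal_self[of F] by (simp add: h_zero)
  finally have solve: "h (indexed_const a) \<otimes>\<^bsub>?S Quot ?J\<^esub> h (indexed_var k) = h g" using gS by simp
  have free: "P = \<zero>\<^bsub>?S\<^esub>" if P: "P \<in> (carrier R)[\<X>\<^bsub>I - {k}\<^esub>]" and "P \<in> ?J" for P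
  proof -
    obtain H where H: "H \<in> (carrier R)[\<X>\<^bsub>I\<^esub>]" "P = mpoly_mult R F H"
      using \<open>P \<in> ?J\<close> F by (auto simp: cgenideal_def mpoly_mult_comm mpoly_carrier_coeff)
    then have "H = indexed_const \<zero>" using mpoly_linear_multiple[OF F lc lin H(1)] P by simp
    then show ?thesis using H F S.r_null[of F] by simp
  qed
  have cancel: "u = \<zero>\<^bsub>?S Quot ?J\<^esub>"
    if "u \<in> carrier (?S Quot ?J)" "h (indexed_const a) [^]\<^bsub>?S Quot ?J\<^esub> (d::nat) \<otimes>\<^bsub>?S Quot ?J\<^esub> u = \<zero>\<^bsub>?S Quot ?J\<^esub>" for u d
    using that
  proof (induction d arbitrary: u)
    case 0
    then show ?case by simp
  next
    case (Suc d)
    let ?v = "h (indexed_const a) \<otimes>\<^bsub>?S Quot ?J\<^esub> u"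
    have yS: "h (indexed_const a) \<in> carrier (?S Quot ?J)" by (rule h.hom_closed[OF a_S])
    have "h (indexed_const a) [^]\<^bsub>?S Quot ?J\<^esub> d \<otimes>\<^bsub>?S Quot ?J\<^esub> ?v = \<zero>\<^bsub>?S Quot ?J\<^esub>"
      using Suc.prems yS by (simp add: h.S.m_assoc)
    then have v: "?v = \<zero>\<^bsub>?S Quot ?J\<^esub>" by (rule Suc.IH[OF h.S.m_closed[OF yS Suc.prems(1)]])
    obtain G where G: "G \<in> carrier ?S" "u = h G"
      using Suc.prems(1) by (auto simp: h_def FactRing_def A_RCOSETS_def')
    then have "indexed_const a \<otimes>\<^bsub>?S\<^esub> G \<in> ?J"
      using v a_S h.hom_mult[of "indexed_const a" G] h_zero[of "indexed_const a \<otimes>\<^bsub>?S\<^esub> G"] by (simp add: mpoly_mult_closed)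
    then have "G \<in> ?J" using mpoly_cancel_const[OF F primitive a, of G] G(1) by simp
    then show ?case using G h_zero by simp
  qed
  show ?thesis
  proof (intro domain.intro domain_axioms.intro)
    show "cring (?S Quot ?J)" by (rule h.S.is_cring)
    show "\<one>\<^bsub>?S Quot ?J\<^esub> \<noteq> \<zero>\<^bsub>?S Quot ?J\<^esub>"
    proof
      assume "\<one>\<^bsub>?S Quot ?J\<^esub> = \<zero>\<^bsub>?S Quot ?J\<^esub>"
      then have "h \<one>\<^bsub>?S\<^esub> = \<zero>\<^bsub>?S Quot ?J\<^esub>" using h.hom_one by simp
      then have "\<one>\<^bsub>?S\<^esub> \<in> ?J" using h_zero S.one_closed by blast
      moreover have "\<one>\<^bsub>?S\<^esub> \<in> (carrier R)[\<X>\<^bsub>I - {k}\<^esub>]" by (simp add: indexed_pset.indexed_const)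
      ultimately show False using free S.one_not_zero by blast
    qed
  next
    fix u v
    assume uv: "u \<otimes>\<^bsub>?S Quot ?J\<^esub> v = \<zero>\<^bsub>?S Quot ?J\<^esub>" "u \<in> carrier (?S Quot ?J)" "v \<in> carrier (?S Quot ?J)"
    obtain G H where GH: "G \<in> (carrier R)[\<X>\<^bsub>I\<^esub>]" "H \<in> (carrier R)[\<X>\<^bsub>I\<^esub>]" "u = h G" "v = h H"
      using uv(2,3) by (auto simp: h_def FactRing_def A_RCOSETS_def')
    note elim = eliminate_variable[OF h.ring_hom_cring_axioms k a(1) g solve]
    obtain d e :: nat and G' H' where red:
      "G' \<in> (carrier R)[\<X>\<^bsub>I - {k}\<^esub>]" "H' \<in> (carrier R)[\<X>\<^bsub>I - {k}\<^esub>]"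
      "h (indexed_const a) [^]\<^bsub>?S Quot ?J\<^esub> d \<otimes>\<^bsub>?S Quot ?J\<^esub> u = h G'"
      "h (indexed_const a) [^]\<^bsub>?S Quot ?J\<^esub> e \<otimes>\<^bsub>?S Quot ?J\<^esub> v = h H'"
      using elim[OF GH(1)] elim[OF GH(2)] unfolding GH(3,4) by blast
    have redS: "G' \<in> carrier ?S" "H' \<in> carrier ?S" using mpoly_mono[of "I - {k}" I] red(1,2) by auto
    let ?y = "h (indexed_const a)"
    have pw: "?y [^]\<^bsub>?S Quot ?J\<^esub> d \<in> carrier (?S Quot ?J)" "?y [^]\<^bsub>?S Quot ?J\<^esub> e \<in> carrier (?S Quot ?J)"
      using a_S by auto
    have "h (G' \<otimes>\<^bsub>?S\<^esub> H') = (?y [^]\<^bsub>?S Quot ?J\<^esub> d \<otimes>\<^bsub>?S Quot ?J\<^esub> ?y [^]\<^bsub>?S Quot ?J\<^esub> e) \<otimes>\<^bsub>?S Quot ?J\<^esub> (u \<otimes>\<^bsub>?S Quot ?J\<^esub> v)"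
      using redS pw uv(2,3) by (simp only: h.hom_mult red(3,4)[symmetric] h.S.m_ac h.S.m_closed)
    also have "\<dots> = \<zero>\<^bsub>?S Quot ?J\<^esub>" using uv pw by simp
    finally have "G' \<otimes>\<^bsub>?S\<^esub> H' \<in> ?J" using redS h_zero S.m_closed by blast
    moreover have "G' \<otimes>\<^bsub>?S\<^esub> H' \<in> (carrier R)[\<X>\<^bsub>I - {k}\<^esub>]" using red(1,2) by (simp add: mpoly_mult_closed)
    ultimately have "G' \<otimes>\<^bsub>?S\<^esub> H' = \<zero>\<^bsub>?S\<^esub>" by (rule free[rotated])
    then have "G' = \<zero>\<^bsub>?S\<^esub> \<or> H' = \<zero>\<^bsub>?S\<^esub>" using S.integral redS by blast
    then have "h G' = \<zero>\<^bsub>?S Quot ?J\<^esub> \<or> h H' = \<zero>\<^bsub>?S Quot ?J\<^esub>" using h.hom_zero by metis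
    then show "u = \<zero>\<^bsub>?S Quot ?J\<^esub> \<or> v = \<zero>\<^bsub>?S Quot ?J\<^esub>"
      using cancel uv(2,3) red(3,4) by metis
  qed
qed

end

context domain
begin

text \<open>
  Here \<open>F = Q p\<close>. If \<open>Q\<close> were a multiple of \<open>F\<close>, then \<open>p\<close> would be a unit; and the constant \<open>p\<close>
  is not a multiple of \<open>F\<close>, because it does not involve \<open>T\<^sub>k\<close>.
\<close>
lemma linear_imprimitive_quotient_not_domain:
  fixes F :: "'c::linorder multiset \<Rightarrow> 'a"
  assumes F: "F \<in> (carrier R)[\<X>\<^bsub>I\<^esub>]" and lc: "F {#k#} \<noteq> \<zero>"
    and lin: "\<And>m. k \<in># m \<Longrightarrow> m \<noteq> {#k#} \<Longrightarrow> F m = \<zero>"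
    and p: "p \<in> carrier R" "p \<noteq> \<zero>" "p \<notin> Units R" and dvd: "\<And>m. F m \<in> PIdl p"
  shows "\<not> domain (mpoly_ring R I Quot PIdl\<^bsub>mpoly_ring R I\<^esub> F)"
proof
  let ?S = "mpoly_ring R I"
  interpret S: domain ?S by (rule mpoly_ring_domain)
  assume "domain (?S Quot PIdl\<^bsub>?S\<^esub> F)"
  then interpret J: primeideal "PIdl\<^bsub>?S\<^esub> F" ?S
    using F by (intro S.quot_domain_imp_primeideal S.cgenideal_ideal) simp
  obtain Q where Q: "Q \<in> (carrier R)[\<X>\<^bsub>I\<^esub>]" "F = mpoly_mult R Q (indexed_const p)"
    using mpoly_const_dvdI[OF p(1) F dvd] by blast
  have const: "indexed_const p \<in> (carrier R)[\<X>\<^bsub>I'\<^esub>]" for I' :: "'c set"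
    by (rule indexed_pset.indexed_const[OF p(1)])
  have const_nz: "indexed_const p \<noteq> (indexed_const \<zero> :: 'c multiset \<Rightarrow> 'a)"
    using p(2) by (auto simp: indexed_const_def dest: fun_cong[of _ _ "{#}"])
  have F_nz: "F \<noteq> indexed_const \<zero>" using lc by (auto simp: indexed_zero_def)
  have "Q \<otimes>\<^bsub>?S\<^esub> indexed_const p \<in> PIdl\<^bsub>?S\<^esub> F" using Q(2) F S.cgenideal_self[of F] by simp
  then consider "Q \<in> PIdl\<^bsub>?S\<^esub> F" | "indexed_const p \<in> PIdl\<^bsub>?S\<^esub> F"
    using J.I_prime[of Q "indexed_const p"] Q(1) const by auto
  then show False
  proof cases
    case 1
    then obtain H where H: "H \<in> (carrier R)[\<X>\<^bsub>I\<^esub>]" "Q = mpoly_mult R H F" by (auto simp: cgenideal_def)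
    have car: "H \<in> carrier ?S" "F \<in> carrier ?S" "indexed_const p \<in> carrier ?S" using H F const by simp_all
    have "F = (H \<otimes>\<^bsub>?S\<^esub> F) \<otimes>\<^bsub>?S\<^esub> indexed_const p" using Q(2) H(2) by simp
    also have "\<dots> = (H \<otimes>\<^bsub>?S\<^esub> indexed_const p) \<otimes>\<^bsub>?S\<^esub> F" using car by (simp only: S.m_ac S.m_closed)
    finally have "\<one>\<^bsub>?S\<^esub> \<otimes>\<^bsub>?S\<^esub> F = (H \<otimes>\<^bsub>?S\<^esub> indexed_const p) \<otimes>\<^bsub>?S\<^esub> F" using car(2) S.l_one by metis
    then have "\<one>\<^bsub>?S\<^esub> = H \<otimes>\<^bsub>?S\<^esub> indexed_const p"
      using car F_nz S.m_rcancel[of F "\<one>\<^bsub>?S\<^esub>" "H \<otimes>\<^bsub>?S\<^esub> indexed_const p"]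
      by (simp add: mpoly_mult_closed indexed_pset.indexed_const)
    then have "\<one> = H {#} \<otimes> p"
      using H(1) p(1) by (simp add: mpoly_mult_const mpoly_carrier_coeff)
        (metis indexed_const_def)
    then have "p \<in> Units R"
      using p(1) mpoly_coeff_closed[OF H(1), of "{#}"] m_comm[of p "H {#}"] by (auto simp: Units_def)
    then show ?thesis using p(3) by contradiction
  next
    case 2
    then obtain H where H: "H \<in> (carrier R)[\<X>\<^bsub>I\<^esub>]" "indexed_const p = mpoly_mult R F H"
      using F by (auto simp: cgenideal_def mpoly_mult_comm mpoly_carrier_coeff)
    then have "H = indexed_const \<zero>" using mpoly_linear_multiple[OF F lc lin H(1)] const by simp
    then show ?thesis using H F S.r_null[of F] const_nz by simp
  qed
qed

end

context cring
begin

lemma finsum_mpoly_coeff: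
  assumes "finite A" "\<And>i. i \<in> A \<Longrightarrow> P i \<in> (carrier R)[\<X>\<^bsub>I\<^esub>]"
  shows "(\<Oplus>\<^bsub>mpoly_ring R I\<^esub>i\<in>A. P i) m = (\<Oplus>i\<in>A. P i m)"
  using assms
proof (induction A)
  case empty
  interpret S: cring "mpoly_ring R I" by (rule mpoly_ring_cring)
  show ?case by (simp add: indexed_zero_def)
next
  case (insert i A)
  interpret S: cring "mpoly_ring R I" by (rule mpoly_ring_cring)
  have "(\<Oplus>\<^bsub>mpoly_ring R I\<^esub>i\<in>insert i A. P i) = P i \<oplus>\<^bsub>mpoly_ring R I\<^esub> (\<Oplus>\<^bsub>mpoly_ring R I\<^esub>i\<in>A. P i)"
    using insert by (intro S.finsum_insert) auto
  moreover have "(\<Oplus>i\<in>insert i A. P i m) = P i m \<oplus> (\<Oplus>i\<in>A. P i m)"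
    using insert.hyps mpoly_coeff_closed[OF insert.prems] by (intro finsum_insert) auto
  ultimately show ?case using insert by (simp add: indexed_padd_def)
qed

lemma mpoly_const_mult_var:
  assumes "c \<in> carrier R"
  shows "mpoly_mult R (indexed_const c) (indexed_var i) = (\<lambda>m. if m = {#i#} then c else \<zero>)"
proof -
  have "indexed_const c \<in> (carrier R)[\<X>\<^bsub>{}\<^esub>]" using assms by (rule indexed_pset.indexed_const)
  then have "mpoly_mult R (indexed_const c) (indexed_var i) = indexed_pmult (indexed_const c) i"
    by (rule mpoly_mult_var)
  also have "\<dots> = (\<lambda>m. if m = {#i#} then c else \<zero>)"
    by (auto simp: indexed_pmult_def indexed_const_def fun_eq_iff dest: insert_DiffM)
  finally show ?thesis .
qed

lemma linear_form_coeffs: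
  fixes fs :: "'c \<Rightarrow> 'a" and f :: 'a and I :: "'c set"
  defines "S \<equiv> mpoly_ring R I"
  defines "F \<equiv> (\<Oplus>\<^bsub>S\<^esub>i\<in>I. indexed_const (fs i) \<otimes>\<^bsub>S\<^esub> indexed_var i) \<oplus>\<^bsub>S\<^esub> indexed_const f"
  assumes "finite I" and fs: "fs \<in> I \<rightarrow> carrier R" and f: "f \<in> carrier R"
  shows "F \<in> (carrier R)[\<X>\<^bsub>I\<^esub>]" "F {#} = f" "\<And>i. i \<in> I \<Longrightarrow> F {#i#} = fs i"
    "\<And>m. m \<noteq> {#} \<Longrightarrow> (\<And>i. i \<in> I \<Longrightarrow> m \<noteq> {#i#}) \<Longrightarrow> F m = \<zero>"
proof -
  interpret S: cring S unfolding S_def by (rule mpoly_ring_cring)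
  let ?t = "\<lambda>i. indexed_const (fs i) \<otimes>\<^bsub>S\<^esub> indexed_var i"
  have t: "?t i \<in> (carrier R)[\<X>\<^bsub>I\<^esub>]" if "i \<in> I" for i
    using fs that by (auto simp: S_def intro!: mpoly_mult_closed indexed_pset.indexed_const indexed_var_mem)
  have sum: "(\<Oplus>\<^bsub>S\<^esub>i\<in>I. ?t i) \<in> (carrier R)[\<X>\<^bsub>I\<^esub>]"
    using S.finsum_closed[of ?t I] t by (auto simp: S_def)
  then show "F \<in> (carrier R)[\<X>\<^bsub>I\<^esub>]"
    using f by (auto simp: F_def S_def intro: indexed_pset.indexed_padd indexed_pset.indexed_const)
  have coeff: "F m = (\<Oplus>i\<in>I. if m = {#i#} then fs i else \<zero>) \<oplus> indexed_const f m" for m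
  proof -
    have "(\<Oplus>\<^bsub>S\<^esub>i\<in>I. ?t i) m = (\<Oplus>i\<in>I. ?t i m)"
      unfolding S_def using \<open>finite I\<close> t by (intro finsum_mpoly_coeff) (auto simp: S_def)
    also have "\<dots> = (\<Oplus>i\<in>I. if m = {#i#} then fs i else \<zero>)"
      using fs by (intro finsum_cong' refl) (auto simp: S_def mpoly_const_mult_var Pi_iff)
    finally show ?thesis by (simp add: F_def S_def indexed_padd_def)
  qed
  show "F {#} = f" using f by (simp add: coeff indexed_const_def)
  show "F {#i#} = fs i" if "i \<in> I" for i
    using finsum_singleton[OF that \<open>finite I\<close> fs] Pi_mem[OF fs that] by (simp add: coeff indexed_const_def)
  show "F m = \<zero>" if "m \<noteq> {#}" "\<And>i. i \<in> I \<Longrightarrow> m \<noteq> {#i#}" for m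
  proof -
    have "(\<Oplus>i\<in>I. if m = {#i#} then fs i else \<zero>) = \<zero>"
      using that(2) by (intro add.finprod_one_eqI) auto
    then show ?thesis using that(1) by (simp add: coeff indexed_const_def)
  qed
qed

end

context factorial_domain
begin

text \<open>
  The ideal \<open>J\<close> lies in \<open>(p)\<close> exactly when \<open>p\<close> divides all coefficients of \<open>F\<close>, which joins the
  criterion for heights to the two lemmas on quotients by a linear polynomial.
\<close>
theorem linear_quotient_domain_iff:
  fixes I :: "'c::linorder set" and fs :: "'c \<Rightarrow> 'a" and f :: 'a
  defines "J \<equiv> Idl (fs ` I \<union> {f})" and "S \<equiv> mpoly_ring R I"
  defines "F \<equiv> (\<Oplus>\<^bsub>S\<^esub>i\<in>I. indexed_const (fs i) \<otimes>\<^bsub>S\<^esub> indexed_var i) \<oplus>\<^bsub>S\<^esub> indexed_const f"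
  assumes "finite I" and fs: "fs \<in> I \<rightarrow> carrier R" and f: "f \<in> carrier R"
    and k: "k \<in> I" "fs k \<noteq> \<zero>"
  shows "domain (S Quot Idl\<^bsub>S\<^esub> {F}) \<longleftrightarrow> J = carrier R \<or> ideal_height R J \<ge> 2"
proof -
  interpret S: domain S unfolding S_def by (rule mpoly_ring_domain)
  note F = linear_form_coeffs[OF \<open>finite I\<close> fs f, folded S_def, folded F_def]
  have lc: "F {#k#} \<noteq> \<zero>" using F(3)[OF k(1)] k(2) by simp
  have lin: "F m = \<zero>" if "k \<in># m" "m \<noteq> {#k#}" for m using that by (intro F(4)) auto
  have gens: "fs ` I \<union> {f} \<subseteq> carrier R" using fs f by auto
  have J: "ideal J R" unfolding J_def by (rule genideal_ideal[OF gens])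
  have "fs k \<in> J" unfolding J_def using genideal_self[OF gens] k(1) by blast
  then have "J \<noteq> {\<zero>}" using k(2) by blast
  note height = ideal_height_ge_2_iff[OF J this]
  have J_sub: "J \<subseteq> PIdl p \<longleftrightarrow> (\<forall>m. F m \<in> PIdl p)" if "p \<in> carrier R" for p
  proof -
    have "J \<subseteq> PIdl p \<longleftrightarrow> fs ` I \<union> {f} \<subseteq> PIdl p"
      unfolding J_def using gens by (rule Idl_subset_ideal[OF cgenideal_ideal[OF that]])
    also have "\<dots> \<longleftrightarrow> (\<forall>m. F m \<in> PIdl p)"
    proof (intro iffI allI)
      fix m assume sub: "fs ` I \<union> {f} \<subseteq> PIdl p"
      have "\<zero> \<in> PIdl p"
        using additive_subgroup.zero_closed[OF ideal.axioms(1)[OF cgenideal_ideal[OF that]]] .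
      then show "F m \<in> PIdl p" using sub F(2-4) by (cases "m = {#} \<or> (\<exists>i\<in>I. m = {#i#})") auto
    next
      assume all: "\<forall>m. F m \<in> PIdl p"
      have "f \<in> PIdl p" using all F(2) by metis
      moreover have "fs i \<in> PIdl p" if "i \<in> I" for i using all F(3)[OF that] by metis
      ultimately show "fs ` I \<union> {f} \<subseteq> PIdl p" by blast
    qed
    finally show ?thesis .
  qed
  have "domain (S Quot PIdl\<^bsub>S\<^esub> F) \<longleftrightarrow> (\<forall>p\<in>carrier R. ring_prime p \<longrightarrow> \<not> J \<subseteq> PIdl p)"
  proof
    assume dom: "domain (S Quot PIdl\<^bsub>S\<^esub> F)"
    show "\<forall>p\<in>carrier R. ring_prime p \<longrightarrow> \<not> J \<subseteq> PIdl p"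
    proof (intro ballI impI notI)
      fix p assume p: "p \<in> carrier R" "ring_prime p" "J \<subseteq> PIdl p"
      then have "p \<noteq> \<zero>" "p \<notin> Units R" by (auto simp: ring_prime_def prime_def)
      then show False
        using linear_imprimitive_quotient_not_domain[OF F(1) lc lin p(1)] p J_sub dom S_def by blast
    qed
  next
    assume "\<forall>p\<in>carrier R. ring_prime p \<longrightarrow> \<not> J \<subseteq> PIdl p"
    then show "domain (S Quot PIdl\<^bsub>S\<^esub> F)"
      unfolding S_def using J_sub
      by (intro linear_primitive_quotient_domain[OF F(1) k(1) lc lin]) auto
  qed
  moreover have "PIdl\<^bsub>S\<^esub> F = Idl\<^bsub>S\<^esub> {F}" using F(1) by (intro S.cgenideal_eq_genideal) (simp add: S_def)
  ultimately show ?thesis using height by simp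
qed

end

theorem lemma4p1:
  fixes R :: "('a, 'b) ring_scheme" and n :: nat and fs :: "nat \<Rightarrow> 'a" and f :: 'a
  assumes "noetherian_domain R" and "factorial_domain R" and "\<not> field R"
    and "\<And>i. i \<in> {1..n} \<Longrightarrow> fs i \<in> carrier R" and "f \<in> carrier R"
    and "\<exists>i\<in>{1..n}. fs i \<noteq> \<zero>\<^bsub>R\<^esub>"
  shows "let J = Idl\<^bsub>R\<^esub> (fs ` {1..n} \<union> {f});
             S = mpoly_ring R {1..n};
             F = (\<Oplus>\<^bsub>S\<^esub>i\<in>{1..n}. ring.indexed_const R (fs i) \<otimes>\<^bsub>S\<^esub> ring.indexed_var R i)
                   \<oplus>\<^bsub>S\<^esub> ring.indexed_const R f;
             A = S Quot (Idl\<^bsub>S\<^esub> {F})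
         in domain A \<longleftrightarrow> J = carrier R \<or> ideal_height R J \<ge> 2"
proof -
  interpret factorial_domain R by fact
  obtain k where "k \<in> {1..n}" "fs k \<noteq> \<zero>\<^bsub>R\<^esub>" using assms(6) by blast
  then show ?thesis
    unfolding Let_def using assms(4,5) by (intro linear_quotient_domain_iff) auto
qed

end
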